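(* For all $n\ge 0$, $\mathcal{F}(A_n)=a_{n+5}$ and $\mathcal{F}(B_n)=b_{n+3}$. Moreover, for all $n\ge 0$ and all integers $r_1,\ldots,r_n\ge 1$, \[ \mathcal{F}(A_n)\leq \mathcal{F}(1,r_1,r_2,\ldots,r_n,1) \leq\mathcal{F}(B_n), \] and these bounds are sharp (for each $n$, each of the two bounds is attained for some choice of $r_1,\ldots,r_n\ge 1$).
   Context: Open chain AND-OR networks. For $n\ge 2$ and operators $\diamondsuit_2,\ldots,\diamondsuit_{n-1}\in\{\wedge,\vee\}$ (logical AND, OR), the AND-OR network with open chain topology is $f=(f_1,\ldots,f_n):\{0,1\}^n\to\{0,1\}^n$ with $f_1(x)=x_2$, $f_i(x)=x_{i-1}\diamondsuit_i x_{i+1}$ for $2\le i\le n-1$, and $f_n(x)=x_{n-1}$. A fixed point is an $x$ with $f(x)=x$. For positive integers $k_1,\ldots,k_m$ with $k_1+\cdots+k_m=n-2$, the sequence $(k_1,\ldots,k_m)$ represents the network whose operator sequence $\diamondsuit_2,\ldots,\diamondsuit_{n-1}$ consists of $m$ consecutive runs of lengths $k_1,\ldots,k_m$, the operator being constant in each run and alternating between $\wedge$ and $\vee$ from one run to the next. $\mathcal{F}(k_1,\ldots,k_m)$ denotes the number of fixed points of this network (it does not depend on whether the first run is $\wedge$ or $\vee$). $A_n=(1,1,\ldots,1,1)$ is the sequence of $n+2$ ones and $B_n=(2,2,\ldots,2,2)$ is the sequence of $n+2$ twos. The sequence $(a_n)$ (Padovan) is defined by $a_0=a_1=a_2=1$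 and $a_n=a_{n-2}+a_{n-3}$ for $n\ge 3$; the sequence $(b_n)$ (Fibonacci) is defined by $b_0=b_1=1$ and $b_n=b_{n-1}+b_{n-2}$ for $n\ge 2$. *)

theory Defs
  imports "HOL-Library.FuncSet" "HOL-Number_Theory.Fib"
begin

datatype junct = And | Or

fun eval_junct :: "junct \<Rightarrow> bool \<Rightarrow> bool \<Rightarrow> bool" where
  "eval_junct And p q = (p \<and> q)"
| "eval_junct Or p q = (p \<or> q)"

fun dual :: "junct \<Rightarrow> junct" where
  "dual And = Or"
| "dual Or = And"

text \<open>
  States of a network with \<open>n\<close> nodes are the extensional functions on \<open>{1..n}\<close>, so that they
  are in bijection with \<open>{0,1}\<^sup>n\<close>. The operator at node \<open>i\<close> is \<open>op i\<close>; only the values for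
  \<open>2 \<le> i \<le> n - 1\<close> are used. The construction is meant for \<open>n \<ge> 2\<close>.
\<close>

definition states :: "nat \<Rightarrow> (nat \<Rightarrow> bool) set" where
  "states n = ({1..n} \<rightarrow>\<^sub>E UNIV)"

definition open_chain :: "nat \<Rightarrow> (nat \<Rightarrow> junct) \<Rightarrow> (nat \<Rightarrow> bool) \<Rightarrow> (nat \<Rightarrow> bool)" where
  "open_chain n op x = (\<lambda>i\<in>{1..n}.
     if i = 1 then x 2
     else if i = n then x (n - 1)
     else eval_junct (op i) (x (i - 1)) (x (i + 1)))"

definition fixed_points :: "nat \<Rightarrow> (nat \<Rightarrow> junct) \<Rightarrow> (nat \<Rightarrow> bool) set" where
  "fixed_points n op = {x \<in> states n. open_chain n op x = x}"

fun runs :: "junct \<Rightarrow> nat list \<Rightarrow> junct list" where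
  "runs c [] = []"
| "runs c (k # ks) = replicate k c @ runs (dual c) ks"

text \<open>
  The list \<open>runs c ks\<close> is the operator sequence of nodes \<open>2, \<dots>, n - 1\<close>, hence the index shift.
\<close>

definition num_fixed :: "junct \<Rightarrow> nat list \<Rightarrow> nat" where
  "num_fixed c ks = card (fixed_points (sum_list ks + 2) (\<lambda>i. runs c ks ! (i - 2)))"

text \<open>
  The first run is taken to be \<open>And\<close>; lemma \<open>num_fixed_eq_fixed_count\<close> below shows that this choice is
  immaterial. The entries of \<open>ks\<close> are meant to be positive.
\<close>

definition fixed_count :: "nat list \<Rightarrow> nat" where
  "fixed_count ks = num_fixed And ks"

lemma length_runs: "length (runs c ks) = sum_list ks"
  by (induction c ks rule: runs.induct) auto

lemma dual_dual [simp]: "dual (dual c) = c"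
  by (cases c) auto

lemma eval_dual: "eval_junct (dual c) p q = (\<not> eval_junct c (\<not> p) (\<not> q))"
  by (cases c) auto

lemma runs_dual: "runs (dual c) ks = map dual (runs c ks)"
  by (induction c ks rule: runs.induct) auto

lemma fixed_points_cong:
  assumes "\<And>i. 2 \<le> i \<Longrightarrow> i < n \<Longrightarrow> op i = op' i"
  shows "fixed_points n op = fixed_points n op'"
proof -
  have "open_chain n op x = open_chain n op' x" for x
    using assms by (auto simp: open_chain_def fun_eq_iff restrict_def)
  then show ?thesis
    by (simp add: fixed_points_def)
qed

lemma negate_fixed_point:
  assumes "n \<ge> 2" "x \<in> fixed_points n op"
  shows "(\<lambda>i\<in>{1..n}. \<not> x i) \<in> fixed_points n (dual \<circ> op)"
proof -
  have fp: "open_chain n op x i = x i" for i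
    using assms by (simp add: fixed_points_def)
  have "open_chain n (dual \<circ> op) (\<lambda>i\<in>{1..n}. \<not> x i) i = (\<not> open_chain n op x i)"
    if i: "i \<in> {1..n}" for i
  proof -
    consider "i = 1" | "i = n" "i \<noteq> 1" | "1 < i" "i < n"
      using i by fastforce
    then show ?thesis
      using assms(1) by cases (auto simp: open_chain_def eval_dual)
  qed
  then have "open_chain n (dual \<circ> op) (\<lambda>i\<in>{1..n}. \<not> x i) i = (\<lambda>i\<in>{1..n}. \<not> x i) i" for i
    by (cases "i \<in> {1..n}") (simp add: fp, auto simp: open_chain_def)
  then show ?thesis
    by (simp add: fixed_points_def states_def fun_eq_iff)
qed

lemma card_fixed_points_dual:
  assumes "n \<ge> 2"
  shows "card (fixed_points n (dual \<circ> op)) = card (fixed_points n op)"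
proof -
  let ?neg = "\<lambda>x. \<lambda>i\<in>{1..n}. \<not> x i"
  have neg_neg: "?neg (?neg x) = x" if "x \<in> fixed_points n op'" for x and op' :: "nat \<Rightarrow> junct"
  proof -
    have "x \<in> extensional {1..n}"
      using that by (simp add: fixed_points_def states_def PiE_def)
    then show ?thesis
      by (simp add: fun_eq_iff restrict_def extensional_def)
  qed
  have "dual \<circ> (dual \<circ> op) = op"
    by (simp add: fun_eq_iff)
  then have neg_back: "?neg x \<in> fixed_points n op" if "x \<in> fixed_points n (dual \<circ> op)" for x
    using negate_fixed_point[OF assms that] by simp
  have "bij_betw ?neg (fixed_points n (dual \<circ> op)) (fixed_points n op)"
  proof (rule bij_betw_byWitness[where f' = ?neg])
    show "\<forall>x\<in>fixed_points n (dual \<circ> op). ?neg (?neg x) = x"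
      using neg_neg by blast
    show "\<forall>x\<in>fixed_points n op. ?neg (?neg x) = x"
      using neg_neg by blast
    show "?neg ` fixed_points n (dual \<circ> op) \<subseteq> fixed_points n op"
      using neg_back by blast
    show "?neg ` fixed_points n op \<subseteq> fixed_points n (dual \<circ> op)"
      using negate_fixed_point[OF assms] by blast
  qed
  then show ?thesis
    by (rule bij_betw_same_card)
qed

lemma num_fixed_eq_fixed_count: "num_fixed c ks = fixed_count ks"
proof -
  have "fixed_points (sum_list ks + 2) (\<lambda>i. runs (dual And) ks ! (i - 2)) =
      fixed_points (sum_list ks + 2) (dual \<circ> (\<lambda>i. runs And ks ! (i - 2)))"
    by (rule fixed_points_cong) (simp add: runs_dual length_runs del: dual.simps)
  then have "num_fixed (dual And) ks = num_fixed And ks"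
    by (simp add: num_fixed_def card_fixed_points_dual del: dual.simps)
  then show ?thesis
    by (cases c) (simp_all add: fixed_count_def)
qed

definition A_seq :: "nat \<Rightarrow> nat list" where
  "A_seq n = replicate (n + 2) 1"

definition B_seq :: "nat \<Rightarrow> nat list" where
  "B_seq n = replicate (n + 2) 2"

fun padovan :: "nat \<Rightarrow> nat" where
  "padovan 0 = 1"
| "padovan (Suc 0) = 1"
| "padovan (Suc (Suc 0)) = 1"
| "padovan (Suc (Suc (Suc n))) = padovan (Suc n) + padovan n"

text \<open>The Fibonacci numbers indexed so that both initial values are \<open>1\<close>.\<close>

fun fibonacci :: "nat \<Rightarrow> nat" where
  "fibonacci 0 = 1"
| "fibonacci (Suc 0) = 1"
| "fibonacci (Suc (Suc n)) = fibonacci (Suc n) + fibonacci n"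

lemma fibonacci_eq_fib: "fibonacci n = fib (n + 1)"
  by (induction n rule: fibonacci.induct) auto

end

theory Submission
  imports Defs "HOL-Library.Product_Order"
begin

text \<open>
  A fixed point is a binary word \<open>x\<^sub>1 \<dots> x\<^sub>n\<close> subject to one condition on each window of three
  consecutive letters, together with \<open>x\<^sub>1 = x\<^sub>2\<close> and \<open>x\<^sub>n\<^sub>-\<^sub>1 = x\<^sub>n\<close>. The fixed points are therefore
  counted by a transfer matrix acting on the last two letters read (\<open>card_chain\<close>). Reading a
  node with operator \<open>c\<close> in state \<open>(p, q)\<close>, with \<open>v\<close> the value absorbing for \<open>c\<close>, there is no
  continuation from \<open>(v, \<not> v)\<close>, so only three of the four states matter in front of a run of \<open>c\<close>.

  Let \<open>a\<close>, \<open>b\<close>, \<open>d\<close> be the numbers of continuations from \<open>(v, v)\<close>, \<open>(\<not> v, v)\<close>, \<open>(\<not> v, \<not> v)\<close> in front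
  of some run. Putting a run of the other operator and of length \<open>k\<close> before it turns \<open>(a, b, d)\<close> into
  \<open>(b + d, d, a)\<close> if \<open>k = 1\<close> and into \<open>(b + d, b + d, a)\<close> if \<open>k \<ge> 2\<close>: from the second node on, a run
  only repeats itself (\<open>ways_replicate\<close>). The number of fixed points is \<open>a + d\<close> in front of the
  first run (\<open>fixed_count_profile\<close>).

  All statements can be read off from this recursion. It is monotone in the triple and in the run
  length, and it does not distinguish lengths \<open>\<ge> 2\<close>, so all ones give the minimum and all twos the
  maximum (\<open>profile_mono\<close>). The lengths of the first and of the last run have no influence on \<open>a + d\<close>
  (\<open>fixed_count_outer_runs\<close>), so \<open>(1, 2, \<dots>, 2, 1)\<close> attains the upper bound. On constant
  sequences the recursion is that of the Padovan and of the Fibonacci numbers.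
\<close>

section \<open>Fixed points as words\<close>

fun chain :: "junct list \<Rightarrow> bool list \<Rightarrow> bool" where
  "chain [] [p, q] = (p = q)"
| "chain (c # cs) (p # q # s # w) = (eval_junct c p s = q \<and> chain cs (q # s # w))"
| "chain _ _ = False"

lemma chain_iff_nth:
  "chain cs w \<longleftrightarrow> length w = length cs + 2 \<and>
     (\<forall>i<length cs. eval_junct (cs ! i) (w ! i) (w ! (i + 2)) = w ! (i + 1)) \<and>
     w ! length cs = w ! (length cs + 1)"
proof (induction cs w rule: chain.induct)
  case (2 c cs p q s w)
  then show ?case
    by (auto simp: All_less_Suc2)
qed auto

text \<open>
  The word of a state carries node \<open>i\<close> at position \<open>i - 1\<close>. The condition at the last node is part of
  \<open>chain\<close>, the one at the first node is not, since it is not inherited by suffixes.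
\<close>

lemma bij_betw_fixed_points_words:
  fixes cs :: "junct list"
  defines "n \<equiv> length cs + 2"
  shows "bij_betw (\<lambda>x. map x [1..<n + 1]) (fixed_points n (\<lambda>i. cs ! (i - 2)))
           {w. chain cs w \<and> w ! 0 = w ! 1}"
proof (rule bij_betw_byWitness[where f' = "\<lambda>w. \<lambda>i\<in>{1..n}. w ! (i - 1)"])
  have nth_word: "map x [1..<n + 1] ! i = x (i + 1)" if "i < n" for x :: "nat \<Rightarrow> bool" and i
    using that by (subst nth_map) (auto simp del: upt_Suc)
  show "\<forall>x\<in>fixed_points n (\<lambda>i. cs ! (i - 2)). (\<lambda>i\<in>{1..n}. map x [1..<n + 1] ! (i - 1)) = x"
  proof
    fix x assume "x \<in> fixed_points n (\<lambda>i. cs ! (i - 2))"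
    then have "x \<in> extensional {1..n}"
      by (simp add: fixed_points_def states_def PiE_def)
    then show "(\<lambda>i\<in>{1..n}. map x [1..<n + 1] ! (i - 1)) = x"
      by (auto simp: fun_eq_iff nth_word extensional_def simp del: upt_Suc map_upt_Suc)
  qed
  show "\<forall>w\<in>{w. chain cs w \<and> w ! 0 = w ! 1}. map (\<lambda>i\<in>{1..n}. w ! (i - 1)) [1..<n + 1] = w"
  proof
    fix w assume "w \<in> {w. chain cs w \<and> w ! 0 = w ! 1}"
    then have "length w = n"
      by (simp add: chain_iff_nth n_def)
    then show "map (\<lambda>i\<in>{1..n}. w ! (i - 1)) [1..<n + 1] = w"
      by (auto intro!: nth_equalityI simp: nth_word simp del: upt_Suc)
  qed
  show "(\<lambda>x. map x [1..<n + 1]) ` fixed_points n (\<lambda>i. cs ! (i - 2))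
          \<subseteq> {w. chain cs w \<and> w ! 0 = w ! 1}"
  proof clarify
    fix x assume "x \<in> fixed_points n (\<lambda>i. cs ! (i - 2))"
    then have fp: "open_chain n (\<lambda>i. cs ! (i - 2)) x i = x i" for i
      by (simp add: fixed_points_def)
    have "eval_junct (cs ! i) (x (i + 1)) (x (i + 3)) = x (i + 2)" if "i < length cs" for i
      using fp[of "i + 2"] that by (simp add: open_chain_def n_def eval_nat_numeral)
    moreover have "x 1 = x 2" "x (n - 1) = x n"
      using fp[of 1] fp[of n] by (auto simp: open_chain_def n_def)
    ultimately show "chain cs (map x [1..<n + 1]) \<and> map x [1..<n + 1] ! 0 = map x [1..<n + 1] ! 1"
      unfolding chain_iff_nth
      by (auto simp: nth_word n_def eval_nat_numeral simp del: upt_Suc)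
  qed
  show "(\<lambda>w. \<lambda>i\<in>{1..n}. w ! (i - 1)) ` {w. chain cs w \<and> w ! 0 = w ! 1}
          \<subseteq> fixed_points n (\<lambda>i. cs ! (i - 2))"
  proof clarify
    fix w assume w: "chain cs w" "w ! 0 = w ! 1"
    let ?x = "\<lambda>i\<in>{1..n}. w ! (i - 1)"
    have "open_chain n (\<lambda>i. cs ! (i - 2)) ?x i = ?x i" for i
    proof -
      consider "i \<notin> {1..n}" | "i = 1" | "i = n" "i \<noteq> 1" | "2 \<le> i" "i < n"
        by fastforce
      then show ?thesis
      proof cases
        case 4
        then have "i - 2 < length cs" "i - 2 + 1 = i - 1" "i - 2 + 2 = i"
          by (auto simp: n_def)
        moreover have "eval_junct (cs ! (i - 2)) (w ! (i - 2)) (w ! (i - 2 + 2)) = w ! (i - 2 + 1)"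
          using w(1) \<open>i - 2 < length cs\<close> by (simp add: chain_iff_nth)
        ultimately show ?thesis
          using 4 by (auto simp: open_chain_def numeral_2_eq_2)
      qed (use w in \<open>auto simp: open_chain_def chain_iff_nth n_def\<close>)
    qed
    then show "?x \<in> fixed_points n (\<lambda>i. cs ! (i - 2))"
      by (auto simp: fixed_points_def states_def)
  qed
qed

section \<open>The transfer recursion\<close>

fun ways :: "junct list \<Rightarrow> bool \<Rightarrow> bool \<Rightarrow> nat" where
  "ways [] p q = of_bool (p = q)"
| "ways (c # cs) p q = (\<Sum>s | eval_junct c p s = q. ways cs q s)"

lemma card_chain: "finite {w. chain cs (p # q # w)} \<and> card {w. chain cs (p # q # w)} = ways cs p q"
proof (induction cs arbitrary: p q)
  case Nil
  have "chain [] (p # q # w) \<longleftrightarrow> w = [] \<and> p = q" for w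
    by (cases w) auto
  then have "{w. chain [] (p # q # w)} = (if p = q then {[]} else {})"
    by auto
  then show ?case
    by simp
next
  case (Cons c cs)
  have "chain (c # cs) (p # q # w) \<longleftrightarrow>
          (\<exists>s u. w = s # u \<and> eval_junct c p s = q \<and> chain cs (q # s # u))" for w
    by (cases w) auto
  then have split: "{w. chain (c # cs) (p # q # w)} =
      (\<Union>s\<in>{s. eval_junct c p s = q}. (#) s ` {u. chain cs (q # s # u)})"
    by auto
  have "card {w. chain (c # cs) (p # q # w)} =
      (\<Sum>s | eval_junct c p s = q. card ((#) s ` {u. chain cs (q # s # u)}))"
    unfolding split using Cons.IH by (intro card_UN_disjoint) auto
  then show ?case
    using Cons.IH by (simp add: split card_image)
qed

lemma num_fixed_eq_ways:
  "num_fixed c ks = ways (runs c ks) False False + ways (runs c ks) True True"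
proof -
  let ?cs = "runs c ks"
  have split: "{w. chain ?cs w \<and> w ! 0 = w ! 1} =
      (\<lambda>w. False # False # w) ` {w. chain ?cs (False # False # w)} \<union>
      (\<lambda>w. True # True # w) ` {w. chain ?cs (True # True # w)}" (is "?L = ?R")
  proof (rule set_eqI)
    fix w
    show "w \<in> ?L \<longleftrightarrow> w \<in> ?R"
    proof (cases "length w \<ge> 2")
      case True
      then obtain p q u where "w = p # q # u"
        by (auto simp: numeral_2_eq_2 Suc_le_length_iff)
      then show ?thesis
        by (cases p; cases q) auto
    qed (auto simp: chain_iff_nth)
  qed
  have "num_fixed c ks = card {w. chain ?cs w \<and> w ! 0 = w ! 1}"
    using bij_betw_same_card[OF bij_betw_fixed_points_words[of ?cs]]
    by (simp add: num_fixed_def length_runs)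
  also have "\<dots> = card ((\<lambda>w. False # False # w) ` {w. chain ?cs (False # False # w)}) +
      card ((\<lambda>w. True # True # w) ` {w. chain ?cs (True # True # w)})"
    unfolding split by (rule card_Un_disjoint) (auto simp: card_chain)
  also have "\<dots> = ways ?cs False False + ways ?cs True True"
    by (simp add: card_image inj_on_def card_chain)
  finally show ?thesis .
qed

section \<open>The effect of a run\<close>

fun absorbing :: "junct \<Rightarrow> bool" where
  "absorbing And = False"
| "absorbing Or = True"

lemma absorbing_dual: "absorbing (dual c) = (\<not> absorbing c)"
  by (cases c) auto

lemma ways_Cons_absorbing:
  fixes c :: junct
  defines "v \<equiv> absorbing c"
  shows "ways (c # cs) v v = ways cs v v + ways cs v (\<not> v)"
    and "ways (c # cs) (\<not> v) v = ways cs v v"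
    and "ways (c # cs) (\<not> v) (\<not> v) = ways cs (\<not> v) (\<not> v)"
    and "ways (c # cs) v (\<not> v) = 0"
proof -
  have "ways (c # cs) p q = (\<Sum>s\<in>UNIV. if eval_junct c p s = q then ways cs q s else 0)" for p q
    using sum.inter_filter[of UNIV "ways cs q" "\<lambda>s. eval_junct c p s = q"] by simp
  then have ways_Cons: "ways (c # cs) p q =
      (if eval_junct c p False = q then ways cs q False else 0) +
      (if eval_junct c p True = q then ways cs q True else 0)" for p q
    by (simp only: UNIV_bool) simp
  show "ways (c # cs) v v = ways cs v v + ways cs v (\<not> v)"
    unfolding v_def ways_Cons by (cases c) auto
  show "ways (c # cs) (\<not> v) v = ways cs v v"
    unfolding v_def ways_Cons by (cases c) auto
  show "ways (c # cs) (\<not> v) (\<not> v) = ways cs (\<not> v) (\<not> v)"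
    unfolding v_def ways_Cons by (cases c) auto
  show "ways (c # cs) v (\<not> v) = 0"
    unfolding v_def ways_Cons by (cases c) auto
qed

text \<open>
  After one node of the run, the state \<open>(v, \<not> v)\<close> is dead; the transfer step then fixes the counts from
  \<open>(v, v)\<close> and \<open>(\<not> v, \<not> v)\<close> and copies the former to \<open>(\<not> v, v)\<close>. Hence nothing changes after the
  second node.
\<close>

lemma ways_replicate:
  fixes c :: junct
  defines "v \<equiv> absorbing c"
  assumes "k \<ge> 1"
  shows "ways (replicate k c @ cs) v v = ways cs v v + ways cs v (\<not> v) \<and>
    ways (replicate k c @ cs) (\<not> v) v = (if k \<le> 1 then ways cs v v else ways cs v v + ways cs v (\<not> v)) \<and>
    ways (replicate k c @ cs) (\<not> v) (\<not> v) = ways cs (\<not> v) (\<not> v) \<and>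
    ways (replicate k c @ cs) v (\<not> v) = 0"
  using assms(2)
proof (induction k rule: nat_induct_at_least)
  case base
  show ?case
    using ways_Cons_absorbing[of c cs] by (simp add: v_def del: ways.simps)
next
  case (Suc k)
  then show ?case
    using ways_Cons_absorbing[of c "replicate k c @ cs"] by (simp add: v_def del: ways.simps)
qed

fun run_step :: "nat \<Rightarrow> nat \<times> nat \<times> nat \<Rightarrow> nat \<times> nat \<times> nat" where
  "run_step k (a, b, d) = (b + d, if k \<le> 1 then d else b + d, a)"

text \<open>
  The components count the continuations from \<open>(v, v)\<close>, \<open>(\<not> v, v)\<close> and \<open>(\<not> v, \<not> v)\<close>, where \<open>v\<close> is the
  absorbing value of the operator of the first run. Because \<open>v\<close> is negated from one run to the
  next, the same step applies to runs of either operator. At the end of the chain the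
  counts \<open>(1, 0, 1)\<close> express \<open>x\<^sub>n\<^sub>-\<^sub>1 = x\<^sub>n\<close>.
\<close>

fun profile :: "nat list \<Rightarrow> nat \<times> nat \<times> nat" where
  "profile [] = (1, 0, 1)"
| "profile (k # ks) = run_step k (profile ks)"

lemma ways_runs:
  assumes "\<forall>k\<in>set ks. k \<ge> 1"
  shows "profile ks = (ways (runs c ks) (absorbing c) (absorbing c),
      ways (runs c ks) (\<not> absorbing c) (absorbing c),
      ways (runs c ks) (\<not> absorbing c) (\<not> absorbing c)) \<and>
    ways (runs c ks) (absorbing c) (\<not> absorbing c) = 0"
  using assms
proof (induction ks arbitrary: c)
  case Nil
  show ?case by simp
next
  case (Cons k ks)
  have "profile ks = (ways (runs (dual c) ks) (\<not> absorbing c) (\<not> absorbing c),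
      ways (runs (dual c) ks) (absorbing c) (\<not> absorbing c),
      ways (runs (dual c) ks) (absorbing c) (absorbing c))"
    using Cons.IH[of "dual c"] Cons.prems by (simp add: absorbing_dual)
  then show ?case
    using ways_replicate[of k c "runs (dual c) ks"] Cons.prems by simp
qed

definition outer_sum :: "nat \<times> nat \<times> nat \<Rightarrow> nat" where
  "outer_sum t = fst t + snd (snd t)"

lemma fixed_count_profile:
  assumes "\<forall>k\<in>set ks. k \<ge> 1"
  shows "fixed_count ks = outer_sum (profile ks)"
  using ways_runs[OF assms, of And]
  by (simp add: fixed_count_def num_fixed_eq_ways outer_sum_def)

section \<open>Comparison of run sequences\<close>

lemma run_step_mono:
  assumes "t \<le> t'" "k \<le> l \<or> 2 \<le> l"
  shows "run_step k t \<le> run_step l t'"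
  using assms by (cases t; cases t') auto

text \<open>
  Lengths from \<open>2\<close> on are equivalent, so a length of at least \<open>2\<close> on the right-hand side dominates
  every length, even a larger one.
\<close>

lemma profile_mono:
  assumes "list_all2 (\<lambda>k l. k \<le> l \<or> 2 \<le> l) ks ls"
  shows "profile ks \<le> profile ls"
  using assms by (induction rule: list_all2_induct) (auto intro: run_step_mono)

lemma outer_sum_mono: "t \<le> t' \<Longrightarrow> outer_sum t \<le> outer_sum t'"
  by (auto simp: outer_sum_def less_eq_prod_def intro: add_mono)

lemma fixed_count_mono:
  assumes "list_all2 (\<lambda>k l. k \<le> l \<or> 2 \<le> l) ks ls" "\<forall>k\<in>set ks. k \<ge> 1" "\<forall>l\<in>set ls. l \<ge> 1"
  shows "fixed_count ks \<le> fixed_count ls"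
  using assms by (simp add: fixed_count_profile outer_sum_mono profile_mono)

text \<open>
  The length of a run affects only the middle count, which the sum for the first run omits; and
  for the last run both cases of the step give \<open>(1, 1, 1)\<close>.
\<close>

lemma fixed_count_outer_runs:
  assumes "\<forall>r\<in>set rs. r \<ge> 1" "k \<ge> 1" "l \<ge> 1" "k' \<ge> 1" "l' \<ge> 1"
  shows "fixed_count (k # rs @ [l]) = fixed_count (k' # rs @ [l'])"
proof -
  have last: "profile (rs @ [l]) = profile (rs @ [l'])"
    by (induction rs) auto
  have first: "outer_sum (run_step k t) = outer_sum (run_step k' t)" for t
    by (cases t) (simp add: outer_sum_def)
  have "outer_sum (profile (k # rs @ [l])) = outer_sum (profile (k' # rs @ [l']))"
    by (simp add: last first[of "profile (rs @ [l'])"])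
  then show ?thesis
    using assms by (simp add: fixed_count_profile)
qed

lemma replicate_outer: "replicate (n + 2) k = k # replicate n k @ [k]"
  by (simp add: replicate_append_same)

section \<open>Constant run sequences\<close>

lemma profile_ones:
  "profile (replicate (n + 2) 1) = (padovan (n + 3), padovan (n + 1), padovan (n + 2))"
  by (induction n) (simp_all add: eval_nat_numeral)

lemma profile_twos:
  "profile (replicate (n + 2) 2) = (fibonacci (n + 2), fibonacci (n + 2), fibonacci (n + 1))"
  by (induction n) (simp_all add: eval_nat_numeral)

lemma fixed_count_A_seq: "fixed_count (A_seq n) = padovan (n + 5)"
proof -
  have "fixed_count (A_seq n) = padovan (n + 3) + padovan (n + 2)"
    unfolding A_seq_def using profile_ones[of n] by (subst fixed_count_profile) (auto simp: outer_sum_def)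
  then show ?thesis
    by (simp add: eval_nat_numeral)
qed

lemma fixed_count_B_seq: "fixed_count (B_seq n) = fibonacci (n + 3)"
proof -
  have "fixed_count (B_seq n) = fibonacci (n + 2) + fibonacci (n + 1)"
    unfolding B_seq_def using profile_twos[of n] by (subst fixed_count_profile) (auto simp: outer_sum_def)
  then show ?thesis
    by (simp add: eval_nat_numeral)
qed

section \<open>Sharp bounds\<close>

theorem corollary2p7:
  fixes n :: nat
  shows "fixed_count (A_seq n) = padovan (n + 5) \<and>
         fixed_count (B_seq n) = fibonacci (n + 3) \<and>
         (\<forall>r :: nat list. length r = n \<and> (\<forall>k\<in>set r. k \<ge> 1) \<longrightarrow>
           fixed_count (A_seq n) \<le> fixed_count (1 # r @ [1]) \<and>
           fixed_count (1 # r @ [1]) \<le> fixed_count (B_seq n)) \<and>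
         (\<exists>r :: nat list. length r = n \<and> (\<forall>k\<in>set r. k \<ge> 1) \<and>
           fixed_count (1 # r @ [1]) = fixed_count (A_seq n)) \<and>
         (\<exists>r :: nat list. length r = n \<and> (\<forall>k\<in>set r. k \<ge> 1) \<and>
           fixed_count (1 # r @ [1]) = fixed_count (B_seq n))"
proof (intro conjI allI impI)
  show "fixed_count (A_seq n) = padovan (n + 5)" "fixed_count (B_seq n) = fibonacci (n + 3)"
    by (rule fixed_count_A_seq fixed_count_B_seq)+
next
  fix r :: "nat list"
  assume "length r = n \<and> (\<forall>k\<in>set r. k \<ge> 1)"
  then have r: "length r = n" "\<forall>k\<in>set r. k \<ge> 1"
    by auto
  have "list_all2 (\<lambda>k l. k \<le> l \<or> 2 \<le> l) (replicate n 1) r"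
    "list_all2 (\<lambda>k l. k \<le> l \<or> 2 \<le> l) r (replicate n 2)"
    using r by (auto simp: list_all2_conv_all_nth)
  then show "fixed_count (A_seq n) \<le> fixed_count (1 # r @ [1])"
    and "fixed_count (1 # r @ [1]) \<le> fixed_count (B_seq n)"
    unfolding A_seq_def B_seq_def replicate_outer using r
    by (intro fixed_count_mono; auto intro: list_all2_appendI)+
next
  show "\<exists>r. length r = n \<and> (\<forall>k\<in>set r. k \<ge> 1) \<and> fixed_count (1 # r @ [1]) = fixed_count (A_seq n)"
    by (rule exI[of _ "replicate n 1"]) (simp add: A_seq_def replicate_append_same)
  have "fixed_count (1 # replicate n 2 @ [1]) = fixed_count (B_seq n)"
    unfolding B_seq_def replicate_outer by (rule fixed_count_outer_runs) auto
  then show "\<exists>r. length r = n \<and> (\<forall>k\<in>set r. k \<ge> 1) \<and> fixed_count (1 # r @ [1]) = fixed_count (B_seq n)"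
    by (intro exI[of _ "replicate n 2"]) simp
qed

end
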